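(* Let $F_k(w)=\tfrac12 w^\top H_k w+l_k^\top w$ for $k=1,\dots,K$, with $H_k\in\mathbb{R}^{d\times d}$ symmetric and $l_k\in\mathbb{R}^d$, let $f=\frac1K\sum_{k=1}^K F_k$ and $H=\frac1K\sum_{k=1}^K H_k$. Assume $H\succ 0$ and let $\hat w=\arg\min_w f(w)$. Let $\mu\ge 0$ be such that $H_k+\mu I\succ 0$ for all $k$, and define $\tilde H^{-1}:=\frac1K\sum_{k=1}^K (H_k+\mu I)^{-1}$. Let $0\le\gamma<1$, $\eta>0$ and define $$\rho:=\|\eta\tilde H^{-1}H-I\|+\frac{\eta\gamma}{K}\sum_{k=1}^K\|(H_k+\mu I)^{-1}H\|.$$ Let $\{w^t\}_{t\ge 0}$ be any sequence of iterates of INEXACTDANE with Option I applied to $f=\frac1K\sum_k F_k$ with parameters $\mu,\eta,\gamma$ and an arbitrary initial point $w^0\in\mathbb{R}^d$. Then for all $t\ge1$, $$\|w^t-\hat w\|\le\rho\,\|w^{t-1}-\hat w\|.$$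
   Context: $\|\cdot\|$ is the Euclidean norm for vectors and the spectral norm for matrices. INEXACTDANE (Option I) for $f=\frac1K\sum_{k=1}^K F_k$ with parameters $\mu\ge0$, $\eta>0$, $0\le\gamma<1$: starting from $w^0$, for $t=1,2,\dots$ and each $k\in\{1,\dots,K\}$ set $$g^t_{k,\mu}(w)=F_k(w)-\langle\nabla F_k(w^{t-1})-\eta\nabla f(w^{t-1}),w\rangle+\tfrac{\mu}{2}\|w-w^{t-1}\|^2,\qquad \hat w_k^t=\arg\min_w g^t_{k,\mu}(w),$$ let $w_k^t$ be any point with $\|w_k^t-\hat w_k^t\|\le\gamma\|w^{t-1}-\hat w_k^t\|$, and put $w^t=\frac1K\sum_{k=1}^K w_k^t$. *)

theory Defs
  imports "HOL-Analysis.Analysis"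
begin

definition gradient :: "('a::real_inner \<Rightarrow> real) \<Rightarrow> 'a \<Rightarrow> 'a" where
  "gradient f x = (THE D. GDERIV f x :> D)"

lemma gradient_eqI:
  assumes "GDERIV f x :> D"
  shows "gradient f x = D"
  unfolding gradient_def
proof (rule the_equality)
  fix E assume "GDERIV f x :> E"
  with assms have "(\<lambda>h. inner h E) = (\<lambda>h. inner h D)"
    unfolding gderiv_def by (rule has_derivative_unique[rotated])
  then have "inner h (E - D) = 0" for h
    by (metis inner_diff_right right_minus_eq)
  then show "E = D"
    by (metis inner_eq_zero_iff right_minus_eq)
qed (rule assms)

definition average :: "nat \<Rightarrow> (nat \<Rightarrow> 'a::real_vector) \<Rightarrow> 'a" where
  "average K x = (1 / real K) *\<^sub>R (\<Sum>k=1..K. x k)"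

definition spectral_norm :: "real^'n^'m \<Rightarrow> real" where
  "spectral_norm A = onorm (\<lambda>x. A *v x)"

definition pos_definite :: "real^'n^'n \<Rightarrow> bool" where
  "pos_definite A \<longleftrightarrow> transpose A = A \<and> (\<forall>x. x \<noteq> 0 \<longrightarrow> x \<bullet> (A *v x) > 0)"

definition minimizer :: "('a \<Rightarrow> real) \<Rightarrow> 'a \<Rightarrow> bool" where
  "minimizer f x \<longleftrightarrow> is_arg_min f (\<lambda>_. True) x"

(* The local objective of the k-th machine for the round that starts from wp. *)
definition dane_local_obj ::
  "nat \<Rightarrow> (nat \<Rightarrow> 'a::real_inner \<Rightarrow> real) \<Rightarrow> real \<Rightarrow> real \<Rightarrow> nat \<Rightarrow> 'a \<Rightarrow> 'a \<Rightarrow> real" where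
  "dane_local_obj K F \<mu> \<eta> k wp w =
     F k w
     - (gradient (F k) wp - \<eta> *\<^sub>R gradient (\<lambda>v. average K (\<lambda>j. F j v)) wp) \<bullet> w
     + \<mu> / 2 * (norm (w - wp))\<^sup>2"

(* One round is a relation between wp and wn, because the inexact local solutions wl k
   may be chosen freely; wh is an exact local solution. *)
definition inexact_dane_step ::
  "nat \<Rightarrow> (nat \<Rightarrow> 'a::real_inner \<Rightarrow> real) \<Rightarrow> real \<Rightarrow> real \<Rightarrow> real \<Rightarrow> 'a \<Rightarrow> 'a \<Rightarrow> bool" where
  "inexact_dane_step K F \<mu> \<eta> \<gamma> wp wn \<longleftrightarrow>
     (\<exists>wl. (\<forall>k\<in>{1..K}. \<exists>wh. minimizer (dane_local_obj K F \<mu> \<eta> k wp) wh \<and>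
                            norm (wl k - wh) \<le> \<gamma> * norm (wp - wh)) \<and>
           wn = average K wl)"

definition inexact_dane_iterates ::
  "nat \<Rightarrow> (nat \<Rightarrow> 'a::real_inner \<Rightarrow> real) \<Rightarrow> real \<Rightarrow> real \<Rightarrow> real \<Rightarrow> (nat \<Rightarrow> 'a) \<Rightarrow> bool" where
  "inexact_dane_iterates K F \<mu> \<eta> \<gamma> w \<longleftrightarrow>
     (\<forall>t\<ge>1. inexact_dane_step K F \<mu> \<eta> \<gamma> (w (t - 1)) (w t))"

end

theory Submission
  imports Defs
begin

text \<open>
  Write $M_k = H_k + \mu I$ and $e = w^{t-1} - \hat w$. Since $\nabla f(\hat w) = 0$, the gradient
  of $f$ at $w^{t-1}$ is $H e$, and the stationarity condition of the $k$-th local problem becomes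
  $\hat w_k^t - w^{t-1} = -\eta M_k^{-1} H e$. Averaging over $k$, the exact local solutions
  contribute the error $(I - \eta \tilde H^{-1} H) e$, while the inexactness adds at most
  $\frac{1}{K} \sum_k \gamma \|\eta M_k^{-1} H e\|$.
\<close>

lemma average_cong: "(\<And>k. k \<in> {1..K} \<Longrightarrow> x k = y k) \<Longrightarrow> average K x = average K y"
  unfolding average_def by (metis sum.cong)

lemma average_add: "average K (\<lambda>k. x k + y k) = average K x + average K y"
  by (simp add: average_def sum.distrib scaleR_right_distrib)

lemma average_scaleR: "average K (\<lambda>k. c *\<^sub>R x k) = c *\<^sub>R average K x"
  by (simp add: average_def scaleR_sum_right mult.commute)

lemma average_const: "K \<ge> 1 \<Longrightarrow> average K (\<lambda>k. c) = c"
  by (simp add: average_def sum_constant_scaleR)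

lemma norm_average_le:
  fixes x :: "nat \<Rightarrow> 'a::real_normed_vector"
  shows "norm (average K x) \<le> average K (\<lambda>k. norm (x k))"
  by (simp add: average_def divide_right_mono norm_sum)

lemma average_mono:
  fixes a b :: "nat \<Rightarrow> real"
  shows "(\<And>k. k \<in> {1..K} \<Longrightarrow> a k \<le> b k) \<Longrightarrow> average K a \<le> average K b"
  unfolding average_def by (intro scaleR_left_mono sum_mono) auto

lemma linear_average:
  assumes "linear g"
  shows "g (average K x) = average K (\<lambda>k. g (x k))"
  using assms by (simp add: average_def linear_scale linear_sum)

lemma average_matrix_vector_mult:
  fixes A :: "nat \<Rightarrow> real^'n^'m"
  shows "average K A *v x = average K (\<lambda>k. A k *v x)"
proof -
  have "linear (\<lambda>B :: real^'n^'m. B *v x)"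
    by (intro linearI) (simp_all add: matrix_vector_mult_add_rdistrib scaleR_matrix_vector_assoc)
  then show ?thesis by (rule linear_average)
qed

lemma GDERIV_average:
  assumes "\<And>k. k \<in> {1..K} \<Longrightarrow> GDERIV (F k) x :> D k"
  shows "GDERIV (\<lambda>v. average K (\<lambda>k. F k v)) x :> average K D"
proof -
  have "((\<lambda>v. average K (\<lambda>k. F k v)) has_derivative (\<lambda>h. average K (\<lambda>k. h \<bullet> D k))) (at x)"
    using assms unfolding average_def gderiv_def
    by (intro has_derivative_scaleR_right has_derivative_sum) auto
  then show ?thesis
    by (simp add: gderiv_def average_def inner_sum_right)
qed

lemma GDERIV_inner_right: "GDERIV (\<lambda>v. c \<bullet> v) x :> c"
  unfolding gderiv_def by (auto intro!: derivative_eq_intros simp: inner_commute)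

lemma GDERIV_half_norm_diff_squared:
  "GDERIV (\<lambda>v. \<mu> / 2 * (norm (v - a))\<^sup>2) x :> \<mu> *\<^sub>R (x - a)"
  unfolding gderiv_def power2_norm_eq_inner
  by (auto intro!: derivative_eq_intros simp: inner_commute)

text \<open>The product rule gives one term with \<open>A *v h\<close> and one with
  \<open>A *v x\<close>; symmetry makes them equal, which cancels the factor 1/2.\<close>

lemma GDERIV_quadratic:
  fixes A :: "real^'n^'n"
  assumes "transpose A = A"
  shows "GDERIV (\<lambda>v. 1 / 2 * (v \<bullet> (A *v v)) + b \<bullet> v) x :> A *v x + b"
proof -
  have sym: "x \<bullet> (A *v h) = h \<bullet> (A *v x)" for h
    by (metis assms dot_lmul_matrix inner_commute transpose_matrix_vector)
  have lin: "((\<lambda>v. A *v v) has_derivative (\<lambda>h. A *v h)) (at x)"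
    by (intro bounded_linear_imp_has_derivative matrix_vector_mul_bounded_linear)
  show ?thesis unfolding gderiv_def
    by (rule derivative_eq_intros lin refl)+
       (auto simp: sym inner_add_right inner_commute[of b])
qed

text \<open>A global minimizer is a local one, so the derivative vanishes in every direction, in
  particular in the direction \<open>D\<close> itself.\<close>

lemma minimizer_GDERIV_zero:
  assumes "minimizer f x" and "GDERIV f x :> D"
  shows "D = 0"
proof -
  have "f x \<le> f y" for y
    using assms(1) by (auto simp: minimizer_def is_arg_min_def not_less)
  then have "(\<lambda>h. h \<bullet> D) = (\<lambda>h. 0)"
    using assms(2) unfolding gderiv_def by (intro has_derivative_local_min) auto
  then have "D \<bullet> D = 0" by meson
  then show ?thesis by simp
qed

text \<open>On a kernel vector the quadratic form is zero, so the kernel is trivial, which suffices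
  for a square matrix.\<close>

lemma pos_definite_invertible: "pos_definite A \<Longrightarrow> invertible A"
  unfolding invertible_left_inverse matrix_left_invertible_ker pos_definite_def
  by (metis inner_zero_right less_irrefl)

lemma matrix_inv_left: "invertible A \<Longrightarrow> matrix_inv A ** A = mat 1"
  unfolding invertible_def matrix_inv_def by (metis (mono_tags, lifting) someI_ex)

lemma norm_matrix_vector_le_spectral_norm:
  fixes A :: "real^'n^'m"
  shows "norm (A *v x) \<le> spectral_norm A * norm x"
  unfolding spectral_norm_def by (intro onorm matrix_vector_mul_bounded_linear)

text \<open>Solves the stationarity condition for the displacement from \<open>wp\<close>. The
  global gradient \<open>g\<close> stays abstract, so only the \<open>k\<close>-th function has to
  be quadratic here; the main proof takes \<open>Hbar *v e\<close> for \<open>g\<close>.\<close>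

lemma dane_local_minimizer_quadratic:
  fixes A :: "real^'n^'n"
  assumes sym: "transpose A = A"
    and F: "\<And>v. F k v = 1 / 2 * (v \<bullet> (A *v v)) + b \<bullet> v"
    and grad: "gradient (\<lambda>v. average K (\<lambda>j. F j v)) wp = g"
    and pos: "pos_definite (A + \<mu> *\<^sub>R mat 1)"
    and min: "minimizer (dane_local_obj K F \<mu> \<eta> k wp) wh"
  shows "wh - wp = - \<eta> *\<^sub>R (matrix_inv (A + \<mu> *\<^sub>R mat 1) *v g)"
proof -
  let ?M = "A + \<mu> *\<^sub>R mat 1"
  have dF: "GDERIV (F k) x :> A *v x + b" for x
    unfolding ext[of "F k", OF F] by (rule GDERIV_quadratic[OF sym])
  have "GDERIV (dane_local_obj K F \<mu> \<eta> k wp) wh :>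
      A *v wh + b - (A *v wp + b - \<eta> *\<^sub>R g) + \<mu> *\<^sub>R (wh - wp)"
    unfolding dane_local_obj_def grad gradient_eqI[OF dF]
    by (intro GDERIV_add GDERIV_diff dF GDERIV_inner_right GDERIV_half_norm_diff_squared)
  from minimizer_GDERIV_zero[OF min this]
  \<comment> \<open>The two copies of \<open>b\<close> cancel, and the terms with \<open>A\<close>
    and \<mu> combine into \<open>?M\<close> applied to the displacement.\<close>
  have "?M *v (wh - wp) = - \<eta> *\<^sub>R g"
    by (simp add: matrix_vector_mult_add_rdistrib matrix_vector_mult_diff_distrib
        scaleR_matrix_vector_assoc[symmetric] algebra_simps)
  then have "matrix_inv ?M *v (?M *v (wh - wp)) = - \<eta> *\<^sub>R (matrix_inv ?M *v g)"
    by (simp only: matrix_vector_mult_scaleR)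
  then show ?thesis
    by (simp only: matrix_vector_mul_assoc matrix_vector_mul_lid
        matrix_inv_left[OF pos_definite_invertible[OF pos]])
qed

theorem theorem1:
  fixes K :: nat
    and H :: "nat \<Rightarrow> real^'d^'d"
    and l :: "nat \<Rightarrow> real^'d"
    and F :: "nat \<Rightarrow> real^'d \<Rightarrow> real"
    and f :: "real^'d \<Rightarrow> real"
    and Hbar Htilde_inv :: "real^'d^'d"
    and what :: "real^'d"
    and \<mu> \<eta> \<gamma> \<rho> :: real
    and w :: "nat \<Rightarrow> real^'d"
  assumes K: "K \<ge> 1"
    and H_sym: "\<And>k. k \<in> {1..K} \<Longrightarrow> transpose (H k) = H k"
    and F: "\<And>k v. k \<in> {1..K} \<Longrightarrow> F k v = 1 / 2 * (v \<bullet> (H k *v v)) + l k \<bullet> v"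
    and f: "f = (\<lambda>v. average K (\<lambda>k. F k v))"
    and Hbar: "Hbar = average K H"
    and Hbar_pos: "pos_definite Hbar"
    and what: "minimizer f what"
    and \<mu>: "\<mu> \<ge> 0"
    and H\<mu>_pos: "\<And>k. k \<in> {1..K} \<Longrightarrow> pos_definite (H k + \<mu> *\<^sub>R mat 1)"
    and Htilde_inv: "Htilde_inv = average K (\<lambda>k. matrix_inv (H k + \<mu> *\<^sub>R mat 1))"
    and \<gamma>: "0 \<le> \<gamma>" "\<gamma> < 1"
    and \<eta>: "\<eta> > 0"
    and \<rho>: "\<rho> = spectral_norm (\<eta> *\<^sub>R (Htilde_inv ** Hbar) - mat 1)
              + \<eta> * \<gamma> / real K
                * (\<Sum>k=1..K. spectral_norm (matrix_inv (H k + \<mu> *\<^sub>R mat 1) ** Hbar))"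
    and iterates: "inexact_dane_iterates K F \<mu> \<eta> \<gamma> w"
  shows "\<forall>t\<ge>1. norm (w t - what) \<le> \<rho> * norm (w (t - 1) - what)"
proof (intro allI impI)
  fix t :: nat
  assume "t \<ge> 1"
  define wp where "wp = w (t - 1)"
  define e where "e = wp - what"
  \<comment> \<open>Here \<open>M k\<close> is already the inverse, that is, the inverse of the
    matrix called M_k in the overview.\<close>
  define M where "M k = matrix_inv (H k + \<mu> *\<^sub>R mat 1)" for k
  define b where "b = average K l"
  have F_eq: "F k = (\<lambda>v. 1 / 2 * (v \<bullet> (H k *v v)) + l k \<bullet> v)" if "k \<in> {1..K}" for k
    using F[OF that] by blast
  have dF: "GDERIV (F k) x :> H k *v x + l k" if "k \<in> {1..K}" for k x
    unfolding F_eq[OF that] by (intro GDERIV_quadratic H_sym that)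
  have df: "GDERIV f x :> Hbar *v x + b" for x
    unfolding f Hbar average_matrix_vector_mult b_def average_add[symmetric]
    by (intro GDERIV_average dF)
  \<comment> \<open>Stationarity of \<open>what\<close> eliminates \<open>b\<close>: the gradient of
    \<open>f\<close> at \<open>wp\<close> then depends on \<open>e\<close> alone.\<close>
  have "Hbar *v what + b = 0"
    using what df by (rule minimizer_GDERIV_zero)
  then have grad: "gradient (\<lambda>v. average K (\<lambda>j. F j v)) wp = Hbar *v e"
    using gradient_eqI[OF df[of wp]] unfolding f e_def
    by (simp add: matrix_vector_mult_diff_distrib add_eq_0_iff)
  \<comment> \<open>The exact solutions exist separately for each \<open>k\<close>; choice collects
    them into a function \<open>wh\<close>.\<close>
  obtain wl wh where
    wh: "\<And>k. k \<in> {1..K} \<Longrightarrow> minimizer (dane_local_obj K F \<mu> \<eta> k wp) (wh k)" and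
    wl: "\<And>k. k \<in> {1..K} \<Longrightarrow> norm (wl k - wh k) \<le> \<gamma> * norm (wp - wh k)" and
    wt: "w t = average K wl"
    using iterates \<open>t \<ge> 1\<close>
    unfolding inexact_dane_iterates_def inexact_dane_step_def wp_def by metis
  have step: "wh k - wp = - \<eta> *\<^sub>R (M k *v (Hbar *v e))" if "k \<in> {1..K}" for k
    unfolding M_def
    using dane_local_minimizer_quadratic[OF H_sym F grad H\<mu>_pos wh] that by blast
  \<comment> \<open>The summand telescopes to \<open>wl k - what\<close>, split into inexactness,
    exact local step and previous error. Constants pass through the average because K \<ge>
    1.\<close>
  have "w t - what = average K (\<lambda>k. (wl k - wh k) + (wh k - wp) + e)"
    using average_add[of K wl "\<lambda>k. - what"] by (simp add: average_const[OF K] e_def wt)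
  also have "\<dots> = average K (\<lambda>k. wl k - wh k) + (average K (\<lambda>k. wh k - wp) + e)"
    by (simp only: average_add average_const[OF K] add.assoc)
  also have "average K (\<lambda>k. wh k - wp) = - \<eta> *\<^sub>R (Htilde_inv *v (Hbar *v e))"
    using average_cong[OF step]
    by (simp only: average_scaleR Htilde_inv average_matrix_vector_mult M_def)
  \<comment> \<open>The sign is pulled out so that the matrix is the one in \<rho>; the norm then
    discards it.\<close>
  also have "\<dots> + e = - ((\<eta> *\<^sub>R (Htilde_inv ** Hbar) - mat 1) *v e)"
    by (simp add: matrix_vector_mult_diff_rdistrib scaleR_matrix_vector_assoc[symmetric]
        matrix_vector_mul_assoc)
  finally have "norm (w t - what) \<le> norm (average K (\<lambda>k. wl k - wh k))
      + norm ((\<eta> *\<^sub>R (Htilde_inv ** Hbar) - mat 1) *v e)"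
    by (metis norm_minus_cancel norm_triangle_ineq)
  also have "norm (average K (\<lambda>k. wl k - wh k))
      \<le> average K (\<lambda>k. \<gamma> * \<eta> * spectral_norm (M k ** Hbar) * norm e)"
  proof (rule order_trans[OF norm_average_le average_mono])
    fix k assume k: "k \<in> {1..K}"
    have "norm (wl k - wh k) \<le> \<gamma> * norm (wh k - wp)"
      using wl[OF k] by (simp add: norm_minus_commute)
    \<comment> \<open>The exact displacement is itself linear in \<open>e\<close>, so the relative
      error tolerance becomes a multiple of \<open>norm e\<close>.\<close>
    also have "\<dots> = \<gamma> * \<eta> * norm ((M k ** Hbar) *v e)"
      using \<eta> by (simp add: step[OF k] matrix_vector_mul_assoc)
    also have "\<dots> \<le> \<gamma> * \<eta> * (spectral_norm (M k ** Hbar) * norm e)"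
      using \<eta> \<gamma> by (intro mult_left_mono norm_matrix_vector_le_spectral_norm) auto
    finally show "norm (wl k - wh k) \<le> \<gamma> * \<eta> * spectral_norm (M k ** Hbar) * norm e"
      by (simp only: mult.assoc)
  qed
  also have "average K (\<lambda>k. \<gamma> * \<eta> * spectral_norm (M k ** Hbar) * norm e)
      = \<eta> * \<gamma> / real K * (\<Sum>k=1..K. spectral_norm (M k ** Hbar)) * norm e"
    by (simp add: average_def sum_distrib_left[symmetric] sum_distrib_right[symmetric])
  \<comment> \<open>This bounds the other summand, the error of the exact step, and supplies the
    first term of \<rho>.\<close>
  also note norm_matrix_vector_le_spectral_norm
  finally show "norm (w t - what) \<le> \<rho> * norm (w (t - 1) - what)"
    by (simp add: \<rho> M_def e_def wp_def distrib_right)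
qed

end
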